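(* Let $Q_{2,1}=\mathrm{conv}\{(0,0),(a,b),(c,d)\}$ and $Q_{2,2}=\mathrm{conv}\{(0,0),(a',b'),(c',d')\}$ be integral $2$-simplices in $\mathbb{R}^2$. For $n>2$ let $$Q_{n,1}=\mathrm{conv}\{\mathbf{0},(a,b,0,\dots,0),(c,d,0,\dots,0),\mathbf{e_3},\dots,\mathbf{e_n}\},\quad Q_{n,2}=\mathrm{conv}\{\mathbf{0},(a',b',0,\dots,0),(c',d',0,\dots,0),\mathbf{e_3},\dots,\mathbf{e_n}\}\subset\mathbb{R}^n,$$ where $\mathbf{e_i}$ are the standard basis vectors. Then $Q_{2,1}$ and $Q_{2,2}$ are unimodularly equivalent if and only if $Q_{n,1}$ and $Q_{n,2}$ are unimodularly equivalent.
   Context: An integral $2$-simplex is a (nondegenerate) triangle with vertices in $\mathbb{Z}^2$; here $a,b,c,d,a',b',c',d'\in\mathbb{Z}$. Two polytopes $P,Q\subset\mathbb{R}^m$ are unimodularly equivalent if there exist $B\in\operatorname{GL}_m(\mathbb{Z})$ and $\mathbf{c}\in\mathbb{Z}^m$ with $\{B\mathbf{v}+\mathbf{c}:\mathbf{v}\in P\}=Q$. *)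

theory Defs
  imports "HOL-Analysis.Analysis"
begin

definition real_vec :: "int ^ 'm \<Rightarrow> real ^ 'm" where
  "real_vec v = (\<chi> i. real_of_int (v $ i))"

(* 'invertible B' is over the ring of integers, i.e. B has a two-sided inverse with
   integer entries, so B ranges over GL_m(Z). *)
definition unimodularly_equivalent :: "(real ^ 'm) set \<Rightarrow> (real ^ 'm) set \<Rightarrow> bool" where
  "unimodularly_equivalent P Q \<longleftrightarrow>
     (\<exists>(B :: int ^ 'm ^ 'm) (c :: int ^ 'm).
        invertible B \<and> {map_matrix real_of_int B *v v + real_vec c | v. v \<in> P} = Q)"

definition integral_simplex :: "int \<Rightarrow> (real ^ 'm) set \<Rightarrow> bool" where
  "integral_simplex k S \<longleftrightarrow>
     k simplex S \<and> (\<forall>v. v extreme_point_of S \<longrightarrow> v \<in> range real_vec)"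

definition Q2 :: "int \<Rightarrow> int \<Rightarrow> int \<Rightarrow> int \<Rightarrow> (real ^ 2) set" where
  "Q2 a b c d = convex hull {0, vector [real_of_int a, real_of_int b],
                                vector [real_of_int c, real_of_int d]}"

(* The coordinates of R^n are indexed by an arbitrary n-element type 'n; the function
   idx, a bijection from {1..n} onto 'n wherever Qn is used, names the first, ..., n-th
   coordinate. *)
definition std_basis :: "(nat \<Rightarrow> 'n) \<Rightarrow> nat \<Rightarrow> real ^ 'n" where
  "std_basis idx i = axis (idx i) 1"

definition Qn :: "nat \<Rightarrow> (nat \<Rightarrow> 'n) \<Rightarrow> int \<Rightarrow> int \<Rightarrow> int \<Rightarrow> int \<Rightarrow> (real ^ 'n) set" where
  "Qn n idx a b c d = convex hull
     ({0, real_of_int a *\<^sub>R std_basis idx 1 + real_of_int b *\<^sub>R std_basis idx 2,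
          real_of_int c *\<^sub>R std_basis idx 1 + real_of_int d *\<^sub>R std_basis idx 2}
      \<union> std_basis idx ` {3..n})"

end

theory Submission
  imports Defs
begin

text \<open>An equivalence of the triangles extends to the coordinates 3, ..., n by fixing the apices
  \<open>e\<^sub>3, ..., e\<^sub>n\<close>. Conversely, an equivalence of the pyramids permutes vertices but may move
  \<open>e\<^sub>i\<close> to another vertex \<open>w\<close>. Then both \<open>e\<^sub>i\<close> and \<open>w\<close> are apices of the target as a lattice
  pyramid, i.e. have integral height 1 over the opposite facet, and two such apices are exchanged by
  the unimodular reflection \<open>x + (h(x) - k(x)) (w - v)\<close>, where \<open>h\<close>, \<open>k\<close> are the heights of
  \<open>v\<close>, \<open>w\<close>, which fixes all other vertices. Composing with such reflections yields an equivalence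
  fixing every \<open>e\<^sub>i\<close>; it maps one triangle to the other and hence preserves the coordinate
  plane they span.\<close>

section \<open>Affine maps preserving the integer lattice\<close>

definition affine_map :: "('a::real_vector \<Rightarrow> 'b::real_vector) \<Rightarrow> bool" where
  "affine_map f \<longleftrightarrow> linear (\<lambda>x. f x - f 0)"

definition lattice_map :: "(real ^ 'm \<Rightarrow> real ^ 'k) \<Rightarrow> bool" where
  "lattice_map f \<longleftrightarrow> affine_map f \<and> f ` range real_vec \<subseteq> range real_vec"

text \<open>The inverse is carried along explicitly, so integrality holds in both directions without
  any determinant. On a space of fixed dimension such pairs are exactly the maps given by a matrix
  in GL_m(Z) followed by an integral translation.\<close>

definition lattice_iso :: "(real ^ 'm \<Rightarrow> real ^ 'k) \<Rightarrow> (real ^ 'k \<Rightarrow> real ^ 'm) \<Rightarrow> bool" where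
  "lattice_iso f g \<longleftrightarrow> lattice_map f \<and> lattice_map g \<and> (\<forall>x. g (f x) = x) \<and> (\<forall>y. f (g y) = y)"

lemma range_real_vec_iff: "x \<in> range real_vec \<longleftrightarrow> (\<forall>i. x $ i \<in> \<int>)"
proof
  assume "\<forall>i. x $ i \<in> \<int>"
  then have "x = real_vec (\<chi> i. \<lfloor>x $ i\<rfloor>)"
    by (simp add: real_vec_def vec_eq_iff)
  then show "x \<in> range real_vec" by blast
qed (auto simp: real_vec_def)

lemma linear_imp_affine_map: "linear f \<Longrightarrow> affine_map f"
  by (simp add: affine_map_def linear_0)

lemma affine_map_const: "affine_map (\<lambda>x. k)"
  by (simp add: affine_map_def linear_zero)

lemma affine_map_ident: "affine_map (\<lambda>x. x)"
  by (simp add: affine_map_def linear_ident)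

lemma affine_map_add:
  assumes "affine_map f" "affine_map g"
  shows "affine_map (\<lambda>x. f x + g x)"
  using linear_compose_add[OF assms[unfolded affine_map_def]]
  by (simp add: affine_map_def algebra_simps)

lemma affine_map_diff:
  assumes "affine_map f" "affine_map g"
  shows "affine_map (\<lambda>x. f x - g x)"
  using linear_compose_sub[OF assms[unfolded affine_map_def]]
  by (simp add: affine_map_def algebra_simps)

lemma affine_map_scaleR_left:
  assumes "affine_map h"
  shows "affine_map (\<lambda>x. h x *\<^sub>R v)"
  using assms unfolding affine_map_def linear_iff
  by (simp add: scaleR_left_diff_distrib[symmetric] scaleR_left_distrib[symmetric])

text \<open>One identity serves several purposes: \<open>z = x\<close> gives affine combinations,
  \<open>r = 1\<close> compares linear parts, and the general form handles the reflection and the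
  lift used later.\<close>

lemma affine_map_combine:
  assumes "affine_map f"
  shows "f (x + r *\<^sub>R (y - z)) = f x + r *\<^sub>R (f y - f z)"
proof -
  interpret linear "\<lambda>x. f x - f 0" using assms by (simp add: affine_map_def)
  show ?thesis
    using add[of x "r *\<^sub>R (y - z)"] unfolding scale diff by (simp add: algebra_simps)
qed

lemma affine_map_compose:
  assumes "affine_map f" "affine_map g"
  shows "affine_map (\<lambda>x. g (f x))"
proof -
  have *: "g (f x) - g (f 0) = ((\<lambda>x. g x - g 0) \<circ> (\<lambda>x. f x - f 0)) x" for x
    using affine_map_combine[OF assms(2), of 0 1 "f x" "f 0"] by simp
  show ?thesis
    unfolding affine_map_def * using assms by (intro linear_compose) (auto simp: affine_map_def)
qed

lemma affine_map_convex_hull: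
  assumes "affine_map f"
  shows "f ` (convex hull S) = convex hull (f ` S)"
proof -
  let ?l = "\<lambda>x. f x - f 0"
  \<comment> \<open>Splits \<open>f\<close> into its linear part followed by the translation by
    \<open>f 0\<close>; both commute with convex hulls.\<close>
  have *: "f ` A = (\<lambda>x. f 0 + x) ` (?l ` A)" for A by (simp add: image_image)
  have "linear ?l" using assms by (simp add: affine_map_def)
  then show ?thesis
    unfolding * convex_hull_translation by (simp only: convex_hull_linear_image)
qed

lemma affine_map_vimage:
  assumes "affine_map f" "affine S"
  shows "affine (f -` S)"
  unfolding affine_alt
proof (intro ballI allI)
  fix x y u assume "x \<in> f -` S" "y \<in> f -` S"
  moreover have "f ((1 - u) *\<^sub>R x + u *\<^sub>R y) = (1 - u) *\<^sub>R f x + u *\<^sub>R f y"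
    using affine_map_combine[OF assms(1), of x u y x] by (simp add: algebra_simps)
  ultimately show "(1 - u) *\<^sub>R x + u *\<^sub>R y \<in> f -` S"
    using assms(2) by (simp add: affine_alt)
qed

lemma lattice_mapI:
  assumes "affine_map f" "\<And>x i. (\<And>j. x $ j \<in> \<int>) \<Longrightarrow> f x $ i \<in> \<int>"
  shows "lattice_map f"
  unfolding lattice_map_def
proof
  have "f x \<in> range real_vec" if "x \<in> range real_vec" for x
    using assms(2) that unfolding range_real_vec_iff by blast
  then show "f ` range real_vec \<subseteq> range real_vec" by blast
qed fact

lemma lattice_mapD: "lattice_map f \<Longrightarrow> x \<in> range real_vec \<Longrightarrow> f x \<in> range real_vec"
  unfolding lattice_map_def by blast

lemma lattice_map_compose:
  assumes "lattice_map f" "lattice_map g"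
  shows "lattice_map (\<lambda>x. g (f x))"
  unfolding lattice_map_def
proof
  show "affine_map (\<lambda>x. g (f x))"
    using assms by (simp add: affine_map_compose lattice_map_def)
  show "(\<lambda>x. g (f x)) ` range real_vec \<subseteq> range real_vec"
    using lattice_mapD[OF assms(2) lattice_mapD[OF assms(1)]] by blast
qed

lemma lattice_iso_compose:
  "lattice_iso f g \<Longrightarrow> lattice_iso f' g' \<Longrightarrow> lattice_iso (\<lambda>x. f' (f x)) (\<lambda>x. g (g' x))"
  by (simp add: lattice_iso_def lattice_map_compose)

section \<open>Integer matrices and lattice isomorphisms\<close>

lemma map_matrix_mult:
  "map_matrix real_of_int (A ** B) = map_matrix real_of_int A ** map_matrix real_of_int B"
  by (simp add: vec_eq_iff matrix_matrix_mult_def)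

lemma map_matrix_mat_1: "map_matrix real_of_int (mat 1) = mat 1"
  by (simp add: vec_eq_iff mat_def)

lemma map_matrix_of_int_inject:
  "map_matrix real_of_int A = map_matrix real_of_int B \<longleftrightarrow> A = B"
  by (simp add: vec_eq_iff)

lemma lattice_map_matrix: "lattice_map (\<lambda>x. map_matrix real_of_int B *v x)"
proof (rule lattice_mapI)
  show "affine_map ((*v) (map_matrix real_of_int B))"
    by (intro linear_imp_affine_map matrix_vector_mul_linear)
qed (auto simp: matrix_vector_mult_def intro!: Ints_sum Ints_mult)

lemma lattice_map_translation:
  assumes "u \<in> range real_vec"
  shows "lattice_map (\<lambda>x. x + u)" "lattice_map (\<lambda>x. x - u)"
  using assms unfolding range_real_vec_iff
  by (simp_all add: lattice_mapI affine_map_add affine_map_diff affine_map_ident affine_map_const)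

text \<open>The columns of the linear part are differences of images of lattice points, hence
  integral. The floor only turns these integral reals into integers.\<close>

lemma lattice_map_matrix_exists:
  fixes f :: "real ^ 'm \<Rightarrow> real ^ 'k"
  assumes "lattice_map f"
  obtains B where "matrix (\<lambda>x. f x - f 0) = map_matrix real_of_int B"
proof
  have "f (axis j 1) $ i \<in> \<int>" "f 0 $ i \<in> \<int>" for i j
    using lattice_mapD[OF assms, of "axis j 1"] lattice_mapD[OF assms, of 0]
    unfolding range_real_vec_iff by (auto simp: axis_def)
  then have "f (axis j 1) $ i - f 0 $ i \<in> \<int>" for i j
    by (rule Ints_diff)
  then show "matrix (\<lambda>x. f x - f 0) =
    map_matrix real_of_int (\<chi> i j. \<lfloor>(f (axis j 1) - f 0) $ i\<rfloor>)"
    by (simp add: vec_eq_iff matrix_def)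
qed

text \<open>The linear parts of \<open>f\<close> and \<open>g\<close> have integer matrices that are
  inverse to each other, and \<open>f 0\<close> is the integral translation vector.\<close>

lemma unimodularly_equivalent_iff_lattice_iso:
  fixes P Q :: "(real ^ 'm) set"
  shows "unimodularly_equivalent P Q \<longleftrightarrow> (\<exists>f g. lattice_iso f g \<and> f ` P = Q)"
proof
  assume "unimodularly_equivalent P Q"
  then obtain B :: "int ^ 'm ^ 'm" and c where B: "invertible B"
    and Q: "{map_matrix real_of_int B *v v + real_vec c | v. v \<in> P} = Q"
    unfolding unimodularly_equivalent_def by blast
  obtain B' where B': "B ** B' = mat 1" "B' ** B = mat 1"
    using B unfolding invertible_def by blast
  let ?f = "\<lambda>v. map_matrix real_of_int B *v v + real_vec c"
  let ?g = "\<lambda>v. map_matrix real_of_int B' *v (v - real_vec c)"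
  have "lattice_iso ?f ?g"
    unfolding lattice_iso_def
    using lattice_map_compose[OF lattice_map_matrix[of B] lattice_map_translation(1)[OF rangeI[of _ c]]]
      lattice_map_compose[OF lattice_map_translation(2)[OF rangeI[of _ c]] lattice_map_matrix[of B']]
    by (simp add: matrix_vector_mul_assoc map_matrix_mult[symmetric] B' map_matrix_mat_1)
  moreover have "?f ` P = Q" using Q by blast
  ultimately show "\<exists>f g. lattice_iso f g \<and> f ` P = Q" by blast
next
  assume "\<exists>f g. lattice_iso f g \<and> f ` P = Q"
  then obtain f g :: "real ^ 'm \<Rightarrow> real ^ 'm" where fg: "lattice_iso f g" and Q: "f ` P = Q" by blast
  let ?F = "\<lambda>x. f x - f 0" and ?G = "\<lambda>x. g x - g 0"
  have aff: "affine_map f" "affine_map g"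
    using fg by (auto simp: lattice_iso_def lattice_map_def)
  then have lin: "linear ?F" "linear ?G" by (auto simp: affine_map_def)
  have lat: "lattice_map f" "lattice_map g" using fg by (auto simp: lattice_iso_def)
  obtain B where B: "matrix ?F = map_matrix real_of_int B"
    by (rule lattice_map_matrix_exists[OF lat(1)])
  obtain B' where B': "matrix ?G = map_matrix real_of_int B'"
    by (rule lattice_map_matrix_exists[OF lat(2)])
  \<comment> \<open>Differences of values see only the linear part, so the linear parts are mutually
    inverse even if the maps move the origin.\<close>
  have "?G (?F x) = x" for x
    using affine_map_combine[OF aff(2), of 0 1 "f x" "f 0"] fg by (simp add: lattice_iso_def)
  then have "?G \<circ> ?F = id" by (simp add: fun_eq_iff)
  then have "matrix ?G ** matrix ?F = mat 1"
    by (simp only: matrix_compose[OF lin, symmetric] matrix_id_mat_1)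
  moreover have "?F (?G x) = x" for x
    using affine_map_combine[OF aff(1), of 0 1 "g x" "g 0"] fg by (simp add: lattice_iso_def)
  then have "?F \<circ> ?G = id" by (simp add: fun_eq_iff)
  then have "matrix ?F ** matrix ?G = mat 1"
    by (simp only: matrix_compose[OF lin(2,1), symmetric] matrix_id_mat_1)
  ultimately have "B' ** B = mat 1" "B ** B' = mat 1"
    by (simp_all only: B B' map_matrix_mult[symmetric] map_matrix_mat_1[symmetric]
        map_matrix_of_int_inject)
  then have "invertible B" unfolding invertible_def by blast
  moreover obtain c where c: "f 0 = real_vec c"
  proof -
    have "f 0 \<in> range real_vec"
      by (rule lattice_mapD[OF lat(1)]) (simp add: range_real_vec_iff)
    then show ?thesis using that by blast
  qed
  have "map_matrix real_of_int B *v v + real_vec c = f v" for v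
    using fun_cong[OF matrix_vector_mul(2)[OF lin(1)], of v] unfolding B c[symmetric] by simp
  then have "{map_matrix real_of_int B *v v + real_vec c | v. v \<in> P} = Q"
    using Q by auto
  ultimately show "unimodularly_equivalent P Q"
    unfolding unimodularly_equivalent_def by blast
qed

text \<open>Affinely independent points are exactly the extreme points of their hull, so an
  equivalence of simplices is a matching of their vertices.\<close>

lemma unimodularly_equivalent_convex_hull_iff:
  fixes S T :: "(real ^ 'm) set"
  assumes S: "\<not> affine_dependent S" and T: "\<not> affine_dependent T"
  shows "unimodularly_equivalent (convex hull S) (convex hull T) \<longleftrightarrow>
    (\<exists>f g. lattice_iso f g \<and> f ` S = T)"
proof -
  have sub: "V \<subseteq> h ` U"
    if "affine_map h" "h ` (convex hull U) = convex hull V" "\<not> affine_dependent V"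
    for h :: "real ^ 'm \<Rightarrow> real ^ 'm" and U V
  proof
    fix x assume "x \<in> V"
    then have "x extreme_point_of (convex hull V)"
      using that(3) by (simp add: extreme_point_of_convex_hull_affine_independent)
    also have "convex hull V = convex hull (h ` U)"
      using that(1,2) by (simp add: affine_map_convex_hull)
    finally show "x \<in> h ` U" by (rule extreme_point_of_convex_hull)
  qed
  have "f ` (convex hull S) = convex hull T \<longleftrightarrow> f ` S = T" if fg: "lattice_iso f g" for f g
  proof
    assume f: "f ` (convex hull S) = convex hull T"
    have inv: "g (f x) = x" "f (g x) = x" for x using fg by (auto simp: lattice_iso_def)
    have "g ` (convex hull T) = convex hull S"
      unfolding f[symmetric] by (simp add: image_image inv)
    \<comment> \<open>The inclusion \<open>sub\<close> applied to the inverse map yields the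
      direction that \<open>f\<close> itself does not give.\<close>
    then have "S \<subseteq> g ` T"
      using fg S by (intro sub) (simp_all add: lattice_iso_def lattice_map_def)
    then have "f ` S \<subseteq> f ` g ` T" by (rule image_mono)
    moreover have "f ` g ` T = T" by (simp add: image_image inv)
    moreover have "T \<subseteq> f ` S"
      using f fg T by (intro sub) (simp_all add: lattice_iso_def lattice_map_def)
    ultimately show "f ` S = T" by simp
  next
    assume "f ` S = T"
    then show "f ` (convex hull S) = convex hull T"
      using fg by (simp add: affine_map_convex_hull lattice_iso_def lattice_map_def)
  qed
  then show ?thesis
    unfolding unimodularly_equivalent_iff_lattice_iso by (intro ex_cong1 conj_cong refl)
qed

section \<open>Apices of lattice pyramids\<close>

text \<open>The simplex with vertex set \<^term>\<open>S\<close> is a lattice pyramid with apex \<^term>\<open>v\<close>: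
  the height over the opposite facet is an integral affine functional.\<close>

definition lattice_apex :: "(real ^ 'm) set \<Rightarrow> real ^ 'm \<Rightarrow> bool" where
  "lattice_apex S v \<longleftrightarrow> (\<exists>h :: real ^ 'm \<Rightarrow> real. affine_map h \<and>
     (\<forall>x \<in> range real_vec. h x \<in> \<int>) \<and> h v = 1 \<and> (\<forall>y \<in> S - {v}. h y = 0))"

lemma lattice_apex_subset: "lattice_apex T v \<Longrightarrow> S \<subseteq> T \<Longrightarrow> lattice_apex S v"
  unfolding lattice_apex_def by blast

text \<open>Composing the height of \<open>v\<close> with the inverse isomorphism \<open>g\<close>
  gives a height for \<open>f v\<close>.\<close>

lemma lattice_apex_image:
  assumes "lattice_iso f g" "lattice_apex S v"
  shows "lattice_apex (f ` S) (f v)"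
proof -
  obtain h :: "real ^ 'a \<Rightarrow> real" where h: "affine_map h" "\<And>x. x \<in> range real_vec \<Longrightarrow> h x \<in> \<int>"
    "h v = 1" "\<And>y. y \<in> S \<Longrightarrow> y \<noteq> v \<Longrightarrow> h y = 0"
    using assms(2) unfolding lattice_apex_def by blast
  have g: "lattice_map g" and inv: "\<And>x. g (f x) = x"
    using assms(1) by (auto simp: lattice_iso_def)
  show ?thesis
    unfolding lattice_apex_def
  proof (intro exI[of _ "\<lambda>x. h (g x)"] conjI ballI)
    show "affine_map (\<lambda>x. h (g x))"
      using g h(1) by (auto simp: lattice_map_def intro: affine_map_compose)
    show "h (g x) \<in> \<int>" if "x \<in> range real_vec" for x
      using h(2) lattice_mapD[OF g that] by blast
    show "h (g (f v)) = 1" by (simp add: inv h)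
    show "h (g y) = 0" if "y \<in> f ` S - {f v}" for y
      using that by (auto simp: inv intro: h(4))
  qed
qed

text \<open>The height vanishes on \<open>S\<close>, hence on its affine hull, but equals 1 at
  \<open>v\<close>.\<close>

lemma lattice_apex_notin_affine_hull:
  assumes "lattice_apex (insert v S) v" "v \<notin> S"
  shows "v \<notin> affine hull S"
proof -
  obtain h :: "real ^ 'a \<Rightarrow> real" where h: "affine_map h" "h v = 1" "\<And>y. y \<in> S \<Longrightarrow> h y = 0"
    using assms unfolding lattice_apex_def by blast
  have "affine hull S \<subseteq> h -` {0}"
    using h by (intro hull_minimal affine_map_vimage) auto
  then show ?thesis using h(2) by auto
qed

text \<open>The apices are added one at a time; the height of each keeps it off the affine hull of
  the points already present.\<close>

lemma affine_independent_union_apices: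
  assumes "finite E" "\<not> affine_dependent S" "S \<inter> E = {}"
    and "\<And>e. e \<in> E \<Longrightarrow> lattice_apex (S \<union> E) e"
  shows "\<not> affine_dependent (S \<union> E)"
  using assms
proof (induction E rule: finite_induct)
  case (insert e E)
  have "lattice_apex (S \<union> E) v" if "v \<in> E" for v
    by (rule lattice_apex_subset[OF insert.prems(3)]) (use that in auto)
  then have "\<not> affine_dependent (S \<union> E)"
    using insert.prems by (intro insert.IH) auto
  moreover have "e \<notin> affine hull (S \<union> E)"
    using insert by (intro lattice_apex_notin_affine_hull) auto
  ultimately show ?case
    using affine_independent_insert by fastforce
qed simp

lemma lattice_apex_swap:
  assumes v: "lattice_apex S v" "v \<in> S" "v \<in> range real_vec"
    and w: "lattice_apex S w" "w \<in> S" "w \<in> range real_vec" and "v \<noteq> w"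
  obtains f where "lattice_iso f f" "f v = w" "f w = v" "\<And>x. x \<in> S - {v, w} \<Longrightarrow> f x = x"
proof -
  obtain h :: "real ^ 'a \<Rightarrow> real" where h: "affine_map h" "\<And>x. x \<in> range real_vec \<Longrightarrow> h x \<in> \<int>"
    "h v = 1" "\<And>y. y \<in> S \<Longrightarrow> y \<noteq> v \<Longrightarrow> h y = 0"
    using v(1) unfolding lattice_apex_def by blast
  obtain k :: "real ^ 'a \<Rightarrow> real" where k: "affine_map k" "\<And>x. x \<in> range real_vec \<Longrightarrow> k x \<in> \<int>"
    "k w = 1" "\<And>y. y \<in> S \<Longrightarrow> y \<noteq> w \<Longrightarrow> k y = 0"
    using w(1) unfolding lattice_apex_def by blast
  \<comment> \<open>the reflection in the hyperplane on which both heights agree\<close>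
  define t where "t = (\<lambda>x. h x - k x)"
  define f where "f = (\<lambda>x. x + t x *\<^sub>R (w - v))"
  \<comment> \<open>As \<open>v\<close> and \<open>w\<close> are distinct points of
    \<open>S\<close>, each height vanishes at the other apex; this gives the values 1 and
    -1.\<close>
  have t: "affine_map t" "t v = 1" "t w = -1" "\<And>x. x \<in> S - {v, w} \<Longrightarrow> t x = 0"
    using h k \<open>v \<noteq> w\<close> v(2) w(2) by (auto simp: t_def intro: affine_map_diff)
  \<comment> \<open>Moving along \<open>w - v\<close> changes \<open>t\<close> at rate
    \<open>t w - t v = -2\<close>, so \<open>t\<close> is negated and a second application of
    \<open>f\<close> undoes the first.\<close>
  have "t (f x) = - t x" for x
    unfolding f_def affine_map_combine[OF t(1)] by (simp add: t)
  then have inv: "f (f x) = x" for x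
    by (subst f_def) (simp add: f_def)
  have "affine_map f"
    unfolding f_def by (intro affine_map_add affine_map_ident affine_map_scaleR_left t)
  moreover have "f x \<in> range real_vec" if "x \<in> range real_vec" for x
  proof -
    have "t x \<in> \<int>" using h(2) k(2) that by (simp add: t_def)
    then show ?thesis
      using that v(3) w(3) unfolding range_real_vec_iff f_def by simp
  qed
  ultimately have "lattice_iso f f"
    by (auto simp: lattice_iso_def lattice_map_def inv)
  then show ?thesis
    using t by (intro that[of f]) (simp_all add: f_def)
qed

text \<open>Induction over the apices: if \<open>e\<close> is not yet fixed, then \<open>f e\<close>
  is an apex of \<open>T\<close> as the image of one of \<open>S\<close>, and the reflection
  swapping \<open>f e\<close> with \<open>e\<close> is composed with \<open>f\<close>.\<close>

lemma lattice_iso_fix_apices: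
  fixes S T :: "(real ^ 'm) set"
  assumes "finite E" "E \<subseteq> S" "E \<subseteq> T" "T \<subseteq> range real_vec"
    and "\<And>e. e \<in> E \<Longrightarrow> lattice_apex S e" "\<And>e. e \<in> E \<Longrightarrow> lattice_apex T e"
    and "\<exists>f g. lattice_iso f g \<and> f ` S = T"
  shows "\<exists>f g. lattice_iso f g \<and> f ` S = T \<and> (\<forall>e\<in>E. f e = e)"
  using assms
proof (induction E rule: finite_induct)
  case (insert e E)
  then obtain f g :: "real ^ 'm \<Rightarrow> real ^ 'm"
    where fg: "lattice_iso f g" and im: "f ` S = T" and fixE: "\<forall>e\<in>E. f e = e" by auto
  show ?case
  proof (cases "f e = e")
    case True
    then show ?thesis using fg im fixE by blast
  next
    case False
    have inj: "f x = f y \<longleftrightarrow> x = y" for x y using fg unfolding lattice_iso_def by metis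
    have mem: "e \<in> S" "e \<in> T" "f e \<in> T" using insert.prems im by auto
    have int: "e \<in> range real_vec" "f e \<in> range real_vec" using mem insert.prems(3) by auto
    have apex: "lattice_apex T (f e)" "lattice_apex T e"
      using lattice_apex_image[OF fg, of S e] insert.prems(4,5) im by auto
    obtain r where r: "lattice_iso r r" "r (f e) = e" "r e = f e"
      "\<And>x. x \<in> T - {f e, e} \<Longrightarrow> r x = x"
      by (rule lattice_apex_swap[OF apex(1) mem(3) int(2) apex(2) mem(2) int(1) False]) blast
    have "r ` T = T"
    proof -
      have sub: "r ` T \<subseteq> T" using r mem by force
      have "r (r x) = x" for x using r(1) by (simp add: lattice_iso_def)
      then have "T = r ` r ` T" by (simp add: image_image)
      then show ?thesis using sub by blast
    qed
    then have "(\<lambda>x. r (f x)) ` S = T" using im by (metis image_image)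
    moreover have "\<forall>e'\<in>insert e E. r (f e') = e'"
    proof
      fix e' assume e': "e' \<in> insert e E"
      show "r (f e') = e'"
      proof (cases "e' = e")
        case False
        then have "e' \<in> E" using e' by simp
        then have "f e' = e'" "e' \<in> T" using fixE insert.prems(2) by auto
        \<comment> \<open>Injectivity of \<open>f\<close> keeps previously fixed apices away from
          \<open>f e\<close>, so the reflection does not disturb them.\<close>
        moreover have "e' \<noteq> f e" using inj[of e' e] False \<open>f e' = e'\<close> by metis
        ultimately show ?thesis using r(4)[of e'] False by simp
      qed (simp add: r)
    qed
    ultimately show ?thesis using lattice_iso_compose[OF fg r(1)] by blast
  qed
next
  case empty
  then show ?case by blast
qed

section \<open>The coordinate plane containing the triangle\<close>

definition plane_embed :: "(nat \<Rightarrow> 'n) \<Rightarrow> real ^ 2 \<Rightarrow> real ^ 'n" where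
  "plane_embed idx x = x $ 1 *\<^sub>R std_basis idx 1 + x $ 2 *\<^sub>R std_basis idx 2"

definition plane_proj :: "(nat \<Rightarrow> 'n) \<Rightarrow> real ^ 'n \<Rightarrow> real ^ 2" where
  "plane_proj idx x = vector [x $ idx 1, x $ idx 2]"

text \<open>For \<open>idx\<close> as in the theorem, this linear functional is 1 at every apex and
  0 on the coordinate plane.\<close>

definition apex_sum :: "nat \<Rightarrow> (nat \<Rightarrow> 'n) \<Rightarrow> real ^ 'n \<Rightarrow> real" where
  "apex_sum n idx x = (\<Sum>i = 3..n. x $ idx i)"

text \<open>Subtracting \<^term>\<open>apex_sum n idx x *\<^sub>R f 0\<close> makes the lift fix the apices even if
  \<^term>\<open>f\<close> moves the origin.\<close>

definition plane_lift :: "nat \<Rightarrow> (nat \<Rightarrow> 'n) \<Rightarrow> (real ^ 2 \<Rightarrow> real ^ 2) \<Rightarrow> real ^ 'n \<Rightarrow> real ^ 'n" where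
  "plane_lift n idx f x =
     plane_embed idx (f (plane_proj idx x) - apex_sum n idx x *\<^sub>R f 0) +
     (x - plane_embed idx (plane_proj idx x))"

definition triangle_vertices :: "int \<Rightarrow> int \<Rightarrow> int \<Rightarrow> int \<Rightarrow> (real ^ 2) set" where
  "triangle_vertices a b c d = {0, vector [of_int a, of_int b], vector [of_int c, of_int d]}"

section \<open>Vertices of the triangles and pyramids\<close>

lemma Q2_eq: "Q2 a b c d = convex hull (triangle_vertices a b c d)"
  by (simp add: Q2_def triangle_vertices_def)

lemma Qn_eq:
  "Qn n idx a b c d =
     convex hull (plane_embed idx ` triangle_vertices a b c d \<union> std_basis idx ` {3..n})"
  unfolding Qn_def triangle_vertices_def image_insert image_empty plane_embed_def vector_2 by simp

lemma triangle_vertices_integral: "triangle_vertices a b c d \<subseteq> range real_vec"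
proof -
  have "(vector [of_int a, of_int b] :: real ^ 2) \<in> range real_vec" for a b
    unfolding range_real_vec_iff forall_2 by simp
  moreover have "(0 :: real ^ 2) \<in> range real_vec" unfolding range_real_vec_iff by simp
  ultimately show ?thesis unfolding triangle_vertices_def by blast
qed

text \<open>A hull of dimension 2 needs at least three points, and only three are listed; so they
  are distinct and affinely independent.\<close>

lemma triangle_vertices_independent:
  assumes "integral_simplex 2 (Q2 a b c d)"
  shows "\<not> affine_dependent (triangle_vertices a b c d)" "card (triangle_vertices a b c d) = 3"
proof -
  let ?V = "triangle_vertices a b c d"
  have dim: "aff_dim ?V = 2"
    using assms aff_dim_simplex by (fastforce simp: integral_simplex_def Q2_eq aff_dim_convex_hull)
  have "finite ?V" "card ?V \<le> 3"
    by (auto simp: triangle_vertices_def card_insert_if)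
  moreover from this have "card ?V \<ge> 3" using aff_dim_le_card[of ?V] dim by simp
  ultimately show "card ?V = 3" "\<not> affine_dependent ?V"
    using dim by (auto simp: affine_independent_iff_card)
qed

lemma triangle_vertices_affine_hull:
  assumes "integral_simplex 2 (Q2 a b c d)"
  shows "affine hull (triangle_vertices a b c d) = UNIV"
  using triangle_vertices_independent[OF assms] by (intro affine_independent_span_eq) auto

lemma linear_plane_embed: "linear (plane_embed idx)"
  by (rule linearI) (auto simp: plane_embed_def algebra_simps)

lemma linear_plane_proj: "linear (plane_proj idx)"
  by (rule linearI) (auto simp: plane_proj_def vec_eq_iff forall_2)

lemma linear_apex_sum: "linear (apex_sum n idx)"
  by (rule linearI) (auto simp: apex_sum_def sum.distrib sum_distrib_left)

lemma lattice_map_plane_embed: "lattice_map (plane_embed idx)"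
  by (rule lattice_mapI)
    (auto simp: linear_imp_affine_map linear_plane_embed plane_embed_def std_basis_def axis_def)

lemma lattice_map_plane_proj: "lattice_map (plane_proj idx)"
proof (rule lattice_mapI)
  show "plane_proj idx x $ i \<in> \<int>" if "\<And>j. x $ j \<in> \<int>" for x i
  proof -
    have "\<forall>i. plane_proj idx x $ i \<in> \<int>"
      unfolding forall_2 plane_proj_def vector_2 using that by blast
    then show ?thesis ..
  qed
qed (simp add: linear_imp_affine_map linear_plane_proj)

section \<open>Pyramids over the coordinate plane\<close>

context
  fixes n :: nat and idx :: "nat \<Rightarrow> 'n::finite"
  assumes n: "n > 2" and idx: "bij_betw idx {1..n} (UNIV :: 'n set)"
begin

lemma idx_eq_iff: "i \<in> {1..n} \<Longrightarrow> j \<in> {1..n} \<Longrightarrow> idx i = idx j \<longleftrightarrow> i = j"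
  by (rule inj_on_eq_iff[OF bij_betw_imp_inj_on[OF idx]])

lemma std_basis_nth:
  "i \<in> {1..n} \<Longrightarrow> j \<in> {1..n} \<Longrightarrow> std_basis idx i $ idx j = (if i = j then 1 else 0)"
  by (auto simp: std_basis_def axis_def idx_eq_iff)

lemma plane_embed_nth: "j \<in> {3..n} \<Longrightarrow> plane_embed idx x $ idx j = 0"
  using n by (simp add: plane_embed_def std_basis_nth)

lemma plane_proj_embed: "plane_proj idx (plane_embed idx x) = x"
  using n by (simp add: plane_proj_def plane_embed_def std_basis_nth vec_eq_iff forall_2)

lemma plane_proj_std_basis: "i \<in> {3..n} \<Longrightarrow> plane_proj idx (std_basis idx i) = 0"
  using n by (simp add: plane_proj_def std_basis_nth vec_eq_iff forall_2)

lemma apex_sum_plane_embed: "apex_sum n idx (plane_embed idx x) = 0"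
  by (simp add: apex_sum_def plane_embed_nth)

lemma apex_sum_std_basis: "i \<in> {3..n} \<Longrightarrow> apex_sum n idx (std_basis idx i) = 1"
  by (simp add: apex_sum_def std_basis_nth)

lemma plane_embed_disjoint: "plane_embed idx ` V \<inter> std_basis idx ` {3..n} = {}"
proof -
  have "plane_embed idx x \<noteq> std_basis idx i" if "i \<in> {3..n}" for x i
    using plane_embed_nth[OF that, of x] std_basis_nth[of i i] that by auto
  then show ?thesis by blast
qed

text \<open>The coordinate belonging to \<open>idx i\<close> serves as the integral height.\<close>

lemma lattice_apex_std_basis:
  assumes "i \<in> {3..n}"
  shows "lattice_apex (plane_embed idx ` V \<union> std_basis idx ` {3..n}) (std_basis idx i)"
  unfolding lattice_apex_def
proof (intro exI[of _ "\<lambda>x. x $ idx i"] conjI ballI)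
  show "affine_map (\<lambda>x::real ^ 'n. x $ idx i)"
    by (intro linear_imp_affine_map linearI) auto
  show "x $ idx i \<in> \<int>" if "x \<in> range real_vec" for x
    using that by (simp add: range_real_vec_iff)
  show "std_basis idx i $ idx i = 1" using assms by (simp add: std_basis_nth)
  show "y $ idx i = 0"
    if "y \<in> plane_embed idx ` V \<union> std_basis idx ` {3..n} - {std_basis idx i}" for y
    using that assms by (auto simp: plane_embed_nth std_basis_nth)
qed

text \<open>The injective linear embedding preserves cardinality and affine dimension of the base;
  the heights of the apices do the rest.\<close>

lemma pyramid_vertices_independent:
  assumes "\<not> affine_dependent V"
  shows "\<not> affine_dependent (plane_embed idx ` V \<union> std_basis idx ` {3..n})"
proof (rule affine_independent_union_apices)
  have "inj (plane_embed idx)" using plane_proj_embed by (metis injI)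
  moreover from this have "card (plane_embed idx ` V) = card V"
    by (meson card_image inj_on_subset subset_UNIV)
  ultimately show "\<not> affine_dependent (plane_embed idx ` V)"
    using assms by (simp add: affine_independent_iff_card
        aff_dim_injective_linear_image[OF linear_plane_embed])
qed (auto simp: plane_embed_disjoint lattice_apex_std_basis)

lemma pyramid_vertices_integral:
  assumes "V \<subseteq> range real_vec"
  shows "plane_embed idx ` V \<union> std_basis idx ` {3..n} \<subseteq> range real_vec"
proof -
  have "std_basis idx i \<in> range real_vec" for i
    unfolding range_real_vec_iff by (simp add: std_basis_def axis_def)
  then show ?thesis using assms lattice_mapD[OF lattice_map_plane_embed] by blast
qed

section \<open>Lifting maps of the plane and restricting them back\<close>

lemma plane_lift_embed: "plane_lift n idx f (plane_embed idx x) = plane_embed idx (f x)"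
  by (simp add: plane_lift_def plane_proj_embed apex_sum_plane_embed)

lemma plane_lift_std_basis:
  "i \<in> {3..n} \<Longrightarrow> plane_lift n idx f (std_basis idx i) = std_basis idx i"
  by (simp add: plane_lift_def plane_proj_std_basis apex_sum_std_basis
      linear_0[OF linear_plane_embed])

lemma lattice_map_plane_lift:
  assumes "lattice_map f"
  shows "lattice_map (plane_lift n idx f)"
  unfolding lattice_map_def
proof
  have f: "affine_map f" using assms by (simp add: lattice_map_def)
  note aff = linear_imp_affine_map[OF linear_plane_embed] linear_imp_affine_map[OF linear_plane_proj]
    linear_imp_affine_map[OF linear_apex_sum]
  show "affine_map (plane_lift n idx f)"
    unfolding plane_lift_def[abs_def]
    by (intro affine_map_add affine_map_diff affine_map_ident affine_map_scaleR_left aff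
        affine_map_compose[OF _ aff(1)] affine_map_compose[OF aff(2) f])
  have "plane_lift n idx f x \<in> range real_vec" if x: "x \<in> range real_vec" for x
  proof -
    have "(0 :: real ^ 2) \<in> range real_vec" unfolding range_real_vec_iff by simp
    then have "f (plane_proj idx x) \<in> range real_vec" "f 0 \<in> range real_vec"
      by (simp_all only: x lattice_mapD[OF assms] lattice_mapD[OF lattice_map_plane_proj])
    moreover have "apex_sum n idx x \<in> \<int>"
      using x unfolding range_real_vec_iff by (auto simp: apex_sum_def intro: Ints_sum)
    ultimately have "f (plane_proj idx x) - apex_sum n idx x *\<^sub>R f 0 \<in> range real_vec"
      unfolding range_real_vec_iff by simp
    then have "plane_embed idx (f (plane_proj idx x) - apex_sum n idx x *\<^sub>R f 0) \<in> range real_vec"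
      "plane_embed idx (plane_proj idx x) \<in> range real_vec"
      by (simp_all only: x lattice_mapD[OF lattice_map_plane_embed]
          lattice_mapD[OF lattice_map_plane_proj])
    then show ?thesis
      using x unfolding plane_lift_def range_real_vec_iff by simp
  qed
  then show "plane_lift n idx f ` range real_vec \<subseteq> range real_vec" by blast
qed

lemma plane_lift_inverse:
  assumes "affine_map g" and inv: "\<And>x. g (f x) = x"
  shows "plane_lift n idx g (plane_lift n idx f x) = x"
proof -
  let ?p = "plane_embed idx" and ?q = "plane_proj idx" and ?s = "apex_sum n idx"
  let ?y = "plane_lift n idx f x"
  \<comment> \<open>The summand is written with \<open>f 0 - 0\<close> to match the shape of
    \<open>affine_map_combine\<close>.\<close>
  have q: "?q ?y = f (?q x) + (- ?s x) *\<^sub>R (f 0 - 0)"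
    by (simp add: plane_lift_def linear_add[OF linear_plane_proj] linear_diff[OF linear_plane_proj]
        plane_proj_embed)
  have s: "?s ?y = ?s x"
    by (simp add: plane_lift_def linear_add[OF linear_apex_sum] linear_diff[OF linear_apex_sum]
        apex_sum_plane_embed)
  \<comment> \<open>Since \<open>g (f 0) = 0\<close>, expanding \<open>g\<close> leaves
    \<open>?s x\<close> times \<open>g 0\<close> as excess, which the correction term in the lift of
    \<open>g\<close> cancels.\<close>
  have "g (?q ?y) - ?s ?y *\<^sub>R g 0 = ?q x"
    unfolding q s affine_map_combine[OF assms(1)] by (simp add: inv)
  moreover have "?y - ?p (?q ?y) = x - ?p (?q x)"
    unfolding q by (simp add: plane_lift_def)
  ultimately show ?thesis unfolding plane_lift_def[of n idx g ?y] by simp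
qed

lemma lattice_iso_plane_lift:
  assumes "lattice_iso f g"
  shows "lattice_iso (plane_lift n idx f) (plane_lift n idx g)"
  using assms unfolding lattice_iso_def
  by (simp add: lattice_map_plane_lift plane_lift_inverse lattice_map_def[of f] lattice_map_def[of g])

text \<open>The points of the plane that \<open>f\<close> keeps in the plane form an affine set
  containing \<open>V\<close>, and \<open>V\<close> spans the plane. The equation expresses
  membership in the embedded plane, on which projecting and embedding again is the identity.\<close>

lemma plane_invariant:
  assumes "affine hull V = UNIV" "affine_map f"
    and "f ` plane_embed idx ` V \<subseteq> plane_embed idx ` W"
  shows "plane_embed idx (plane_proj idx (f (plane_embed idx x))) = f (plane_embed idx x)"
proof -
  let ?A = "(\<lambda>x. f (plane_embed idx x)) -` range (plane_embed idx)"
  have "affine (range (plane_embed idx))"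
    using linear_plane_embed by (intro subspace_imp_affine linear_subspace_image) auto
  then have "affine ?A"
    by (intro affine_map_vimage affine_map_compose[OF linear_imp_affine_map[OF linear_plane_embed]]
        assms)
  moreover have "V \<subseteq> ?A" using assms(3) by blast
  ultimately have "affine hull V \<subseteq> ?A" by (simp only: hull_minimal)
  then obtain z where "f (plane_embed idx x) = plane_embed idx z" using assms(1) by blast
  then show ?thesis by (simp add: plane_proj_embed)
qed

text \<open>Both \<open>f\<close> and \<open>g\<close> preserve the embedded plane, so conjugating
  them with embedding and projection yields mutually inverse maps of the plane.\<close>

lemma lattice_iso_plane_restrict:
  assumes fg: "lattice_iso f g"
    and V: "affine hull V = UNIV" and W: "affine hull W = UNIV"
    and im: "f ` plane_embed idx ` V = plane_embed idx ` W"
  shows "\<exists>f' g'. lattice_iso f' g' \<and> f' ` V = W"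
proof (intro exI conjI)
  let ?p = "plane_embed idx" and ?q = "plane_proj idx"
  have f: "lattice_map f" "affine_map f" and g: "lattice_map g" "affine_map g"
    and inv: "\<And>x. g (f x) = x" "\<And>x. f (g x) = x"
    using fg by (auto simp: lattice_iso_def lattice_map_def)
  have "g ` ?p ` W = ?p ` V"
    unfolding im[symmetric] by (simp add: image_image inv)
  then have "?p (?q (f (?p x))) = f (?p x)" "?p (?q (g (?p x))) = g (?p x)" for x
    using plane_invariant[OF V f(2) equalityD1[OF im]] plane_invariant[OF W g(2) equalityD1]
    by simp_all
  then show "lattice_iso (\<lambda>x. ?q (f (?p x))) (\<lambda>x. ?q (g (?p x)))"
    unfolding lattice_iso_def
    using lattice_map_compose[OF lattice_map_compose[OF lattice_map_plane_embed f(1)]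
        lattice_map_plane_proj]
      lattice_map_compose[OF lattice_map_compose[OF lattice_map_plane_embed g(1)]
        lattice_map_plane_proj]
    by (simp add: inv plane_proj_embed)
  have "(\<lambda>x. ?q (f (?p x))) ` V = ?q ` f ` ?p ` V" by (simp add: image_image)
  then show "(\<lambda>x. ?q (f (?p x))) ` V = W"
    unfolding im by (simp add: image_image plane_proj_embed)
qed

text \<open>Forwards, the lift carries base to base and fixes the apices. Backwards, the equivalence
  is first corrected to fix every apex and then restricted to the plane.\<close>

lemma lattice_iso_pyramid_iff:
  assumes V: "affine hull V = UNIV" and W: "affine hull W = UNIV" "W \<subseteq> range real_vec"
  shows "(\<exists>f g. lattice_iso f g \<and> f ` V = W) \<longleftrightarrow>
    (\<exists>f g. lattice_iso f g \<and> f ` (plane_embed idx ` V \<union> std_basis idx ` {3..n}) =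
      plane_embed idx ` W \<union> std_basis idx ` {3..n})"
    (is "?L \<longleftrightarrow> (\<exists>f g. lattice_iso f g \<and> f ` (?V \<union> ?E) = ?W \<union> ?E)")
proof
  assume ?L
  then obtain f g where fg: "lattice_iso f g" "f ` V = W" by blast
  have "plane_lift n idx f ` ?V = ?W"
    unfolding fg(2)[symmetric] by (simp add: image_image plane_lift_embed)
  moreover have "plane_lift n idx f ` ?E = ?E"
    by (simp add: image_image plane_lift_std_basis)
  ultimately have "plane_lift n idx f ` (?V \<union> ?E) = ?W \<union> ?E" by (simp add: image_Un)
  then show "\<exists>f g. lattice_iso f g \<and> f ` (?V \<union> ?E) = ?W \<union> ?E"
    using lattice_iso_plane_lift[OF fg(1)] by blast
next
  assume ex: "\<exists>f g. lattice_iso f g \<and> f ` (?V \<union> ?E) = ?W \<union> ?E"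
  have apex: "lattice_apex (plane_embed idx ` U \<union> ?E) e" if "e \<in> ?E" for e U
    using that by (elim imageE) (simp only: lattice_apex_std_basis)
  have "\<exists>f g. lattice_iso f g \<and> f ` (?V \<union> ?E) = ?W \<union> ?E \<and> (\<forall>e\<in>?E. f e = e)"
  proof (rule lattice_iso_fix_apices)
    show "finite ?E" by simp
    show "?E \<subseteq> ?V \<union> ?E" "?E \<subseteq> ?W \<union> ?E" by simp_all
    show "?W \<union> ?E \<subseteq> range real_vec" by (rule pyramid_vertices_integral[OF W(2)])
  qed (fact apex ex)+
  then obtain f g where fg: "lattice_iso f g" and im: "f ` (?V \<union> ?E) = ?W \<union> ?E"
    and fixE: "\<forall>e\<in>?E. f e = e" by (elim exE conjE)
  have "inj f" using fg by (intro inj_on_inverseI[of _ g]) (simp add: lattice_iso_def)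
  have "f ` ?E = ?E" using fixE by (simp add: image_image)
  \<comment> \<open>An injective map respects set differences, so removing the fixed apices on both
    sides leaves the bases.\<close>
  moreover have "(?V \<union> ?E) - ?E = ?V" "(?W \<union> ?E) - ?E = ?W"
    using plane_embed_disjoint by blast+
  ultimately have "f ` ?V = ?W"
    using image_set_diff[OF \<open>inj f\<close>, of "?V \<union> ?E" ?E] by (simp only: im)
  then show ?L by (rule lattice_iso_plane_restrict[OF fg V W(1)])
qed

end

theorem theorem4p1:
  fixes a b c d a' b' c' d' :: int
    and n :: nat and idx :: "nat \<Rightarrow> 'n::finite"
  assumes "integral_simplex 2 (Q2 a b c d)"
    and "integral_simplex 2 (Q2 a' b' c' d')"
    and "n > 2"
    and "bij_betw idx {1..n} (UNIV :: 'n set)"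
  shows "unimodularly_equivalent (Q2 a b c d) (Q2 a' b' c' d') \<longleftrightarrow>
         unimodularly_equivalent (Qn n idx a b c d) (Qn n idx a' b' c' d')"
proof -
  note indep = triangle_vertices_independent(1)[OF assms(1)]
    triangle_vertices_independent(1)[OF assms(2)]
  note nidx = assms(3,4)
  show ?thesis
    \<comment> \<open>Affine independence in both dimensions replaces the four polytopes by their
      vertex sets.\<close>
    unfolding Q2_eq Qn_eq unimodularly_equivalent_convex_hull_iff[OF indep]
      unimodularly_equivalent_convex_hull_iff[OF
        pyramid_vertices_independent[OF nidx indep(1)] pyramid_vertices_independent[OF nidx indep(2)]]
    using triangle_vertices_affine_hull[OF assms(1)] triangle_vertices_affine_hull[OF assms(2)]
      triangle_vertices_integral
    by (rule lattice_iso_pyramid_iff[OF nidx])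
qed

end
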